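(* Let $\alpha\in\mathbb{C}$ with $|\alpha|<1$, and let $\theta$ be a real number with $|\theta|=\frac{2\pi q}{p}\le\pi$ for integers $p\ge 1$, $q\ge 0$. Let $X^3_{\alpha,\theta}$ be the set of sums determined by all alternating sequences with parameter $\theta$ (see context). Let $K^3_{\alpha,\theta}\subset\mathbb{C}$ be the self-similar set generated by the iterated function system $$\psi_1(z)=\alpha z,\qquad \psi_2(z)=(\alpha e^{i\theta})\overline{z}+\alpha,$$ i.e. the unique nonempty compact set with $K^3_{\alpha,\theta}=\psi_1(K^3_{\alpha,\theta})\cup\psi_2(K^3_{\alpha,\theta})$. Then $$\bigcup_{k=0}^{p-1}(e^{i\theta})^k K^3_{\alpha,\theta}=X^3_{\alpha,\theta}.$$
   Context: $\mathbb{N}=\{1,2,3,\dots\}$. For $p,\theta$ as in the claim put $\Delta_\theta:=\{0,1,e^{i\theta},e^{2i\theta},\dots,e^{(p-1)i\theta}\}$. A sequence $(\delta_1,\delta_2,\dots)\in\Delta_\theta^{\mathbb{N}}$ satisfies the Alternating Condition (AC) if: (1) $\delta_1\in\Delta_\theta$ is free to choose; (2) if $\delta_1=\dots=\delta_k=0$, then $\delta_{k+1}\in\Delta_\theta$ is free to choose; (3) otherwise, with $j_0(k):=\max\{j\le k:\delta_j\neq 0\}$ and $N_{j_0(k)}:=\#\{j\le j_0(k):\delta_j\neq 0\}$, either $\delta_{k+1}=0$, or $\delta_{k+1}=e^{i\theta}\delta_{j_0(k)}$ if $N_{j_0(k)}$ is odd, and $\delta_{k+1}=e^{-i\theta}\delta_{j_0(k)}$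 if $N_{j_0(k)}$ is even. Let $W^A_\theta$ be the set of all sequences in $\Delta_\theta^{\mathbb{N}}$ satisfying the AC. Given $(\delta_n)\in W^A_\theta$, define $(\xi_j)$ by $\xi_1=\alpha$ and, for $j\ge1$, $\xi_{j+1}=\xi_j$ if $\delta_j=0$ and $\xi_{j+1}=\overline{\xi_j}$ if $\delta_j\neq 0$ (so $(\xi_j)$ depends on $(\delta_n)$). Then $$X^3_{\alpha,\theta}:=\left\{\sum_{n=1}^\infty\delta_n\prod_{j=1}^n\xi_j:(\delta_1,\delta_2,\dots)\in W^A_\theta\right\}.$$ For $c\in\mathbb{C}$ and $A\subset\mathbb{C}$, $cA:=\{ca:a\in A\}$. The superscript $3$ in $X^3,K^3$ is a label, not a power. *)

theory Defs
  imports "HOL-Analysis.Analysis"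
begin

(* Sequences (delta_1, delta_2, ...) are functions nat => complex read at positive
   indices only; the value at 0 is unconstrained and never used. *)

definition Delta :: "nat \<Rightarrow> real \<Rightarrow> complex set" where
  "Delta p \<theta> = insert 0 {cis (real k * \<theta>) | k. k < p}"

definition last_nonzero :: "(nat \<Rightarrow> complex) \<Rightarrow> nat \<Rightarrow> nat" where
  "last_nonzero \<delta> k = Max {j \<in> {1..k}. \<delta> j \<noteq> 0}"

definition num_nonzero :: "(nat \<Rightarrow> complex) \<Rightarrow> nat \<Rightarrow> nat" where
  "num_nonzero \<delta> m = card {j \<in> {1..m}. \<delta> j \<noteq> 0}"

(* Clauses (1) and (2) of the condition impose nothing beyond membership in Delta, so
   only clause (3) appears; its guard also ensures that last_nonzero is the maximum of
   a nonempty set. *)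
definition alternating :: "real \<Rightarrow> (nat \<Rightarrow> complex) \<Rightarrow> bool" where
  "alternating \<theta> \<delta> \<longleftrightarrow>
     (\<forall>k\<ge>1. \<not> (\<forall>j\<in>{1..k}. \<delta> j = 0) \<longrightarrow>
        (let m = last_nonzero \<delta> k in
           \<delta> (k + 1) = 0 \<or>
           \<delta> (k + 1) = (if odd (num_nonzero \<delta> m) then cis \<theta> * \<delta> m else cis (- \<theta>) * \<delta> m)))"

definition W_alt :: "nat \<Rightarrow> real \<Rightarrow> (nat \<Rightarrow> complex) set" where
  "W_alt p \<theta> = {\<delta>. (\<forall>n\<ge>1. \<delta> n \<in> Delta p \<theta>) \<and> alternating \<theta> \<delta>}"

(* The value at index 0 is a dummy; xi \<alpha> \<delta> 1 = \<alpha>. *)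
primrec xi :: "complex \<Rightarrow> (nat \<Rightarrow> complex) \<Rightarrow> nat \<Rightarrow> complex" where
  "xi \<alpha> \<delta> 0 = \<alpha>"
| "xi \<alpha> \<delta> (Suc j) =
     (if j = 0 then \<alpha> else if \<delta> j = 0 then xi \<alpha> \<delta> j else cnj (xi \<alpha> \<delta> j))"

(* The series over n >= 1 is reindexed to start at 0. *)
definition X3 :: "nat \<Rightarrow> complex \<Rightarrow> real \<Rightarrow> complex set" where
  "X3 p \<alpha> \<theta> = {(\<Sum>n. \<delta> (Suc n) * (\<Prod>j=1..Suc n. xi \<alpha> \<delta> j)) | \<delta>. \<delta> \<in> W_alt p \<theta>}"

definition psi1 :: "complex \<Rightarrow> complex \<Rightarrow> complex" where
  "psi1 \<alpha> z = \<alpha> * z"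

definition psi2 :: "complex \<Rightarrow> real \<Rightarrow> complex \<Rightarrow> complex" where
  "psi2 \<alpha> \<theta> z = (\<alpha> * cis \<theta>) * cnj z + \<alpha>"

(* Both maps are contractions of ratio |\<alpha>|, so by Hutchinson's theorem the description
   determines a set whenever |\<alpha>| < 1. *)
definition K3 :: "complex \<Rightarrow> real \<Rightarrow> complex set" where
  "K3 \<alpha> \<theta> = (THE K. compact K \<and> K \<noteq> {} \<and> K = psi1 \<alpha> ` K \<union> psi2 \<alpha> \<theta> ` K)"

end

theory Submission imports Defs begin

text \<open>
  Once the first nonzero digit \<open>w\<close> of an alternating sequence is known, the sequence is determined
  by the set of positions of its nonzero digits, because the nonzero digits are
  \<open>w, e\<^sup>i\<^sup>\<theta>w, w, e\<^sup>i\<^sup>\<theta>w, \<dots>\<close> in turn (\<open>alternating_iff\<close>). Since \<open>\<xi>\<close> also depends only on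
  these positions, and since \<open>p\<theta>\<close> is a multiple of \<open>2\<pi>\<close>, the set \<open>X\<^sup>3\<close> is the union of the
  rotations by \<open>(e\<^sup>i\<^sup>\<theta>)\<^sup>k\<close> of the set of all values \<open>address_value \<alpha> \<theta> b\<close>, where the Boolean
  sequence \<open>b\<close> marks the nonzero positions and the first nonzero digit is \<open>1\<close>.

  It remains to see that these values form \<open>K\<^sup>3\<close>. Splitting off the first term of the series
  gives \<open>address_value \<alpha> \<theta> b = \<psi> (address_value \<alpha> \<theta> (shift of b))\<close>, where \<open>\<psi>\<close> is \<open>\<psi>\<^sub>2\<close> or \<open>\<psi>\<^sub>1\<close>
  according to \<open>b 0\<close>: if the first digit is \<open>0\<close>, the rest of the series is multiplied by \<open>\<alpha>\<close>; if
  it is \<open>1\<close>, then \<open>\<xi>\<close> is conjugated and the later nonzero digits \<open>e\<^sup>i\<^sup>\<theta>, 1, e\<^sup>i\<^sup>\<theta>, \<dots>\<close> are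
  \<open>e\<^sup>i\<^sup>\<theta>\<close> times the conjugates of \<open>1, e\<^sup>i\<^sup>\<theta>, 1, \<dots>\<close>, which are the digits for the shift of \<open>b\<close>.
  So \<open>b\<close> is an address of its value in the sense of iterated function systems, and contraction
  shows that every nonempty compact invariant set equals the set of values
  (\<open>compact_invariant_eq\<close>). For existence, the closure of the set of values is compact and
  invariant, hence it is itself the set of values.
\<close>

section \<open>Series attached to a Boolean address\<close>

primrec hits :: "(nat \<Rightarrow> bool) \<Rightarrow> nat \<Rightarrow> nat" where
  "hits b 0 = 0"
| "hits b (Suc n) = hits b n + of_bool (b n)"

definition shift :: "(nat \<Rightarrow> bool) \<Rightarrow> nat \<Rightarrow> bool" where
  "shift b n = b (Suc n)"

definition phase :: "real \<Rightarrow> nat \<Rightarrow> complex" where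
  "phase \<theta> k = (if even k then 1 else cis \<theta>)"

definition cnj_iter :: "complex \<Rightarrow> nat \<Rightarrow> complex" where
  "cnj_iter \<alpha> k = (if even k then \<alpha> else cnj \<alpha>)"

definition address_digit :: "real \<Rightarrow> (nat \<Rightarrow> bool) \<Rightarrow> nat \<Rightarrow> complex" where
  "address_digit \<theta> b n = (if b n then phase \<theta> (hits b n) else 0)"

definition address_term :: "complex \<Rightarrow> real \<Rightarrow> (nat \<Rightarrow> bool) \<Rightarrow> nat \<Rightarrow> complex" where
  "address_term \<alpha> \<theta> b n = address_digit \<theta> b n * (\<Prod>j\<le>n. cnj_iter \<alpha> (hits b j))"

definition address_value :: "complex \<Rightarrow> real \<Rightarrow> (nat \<Rightarrow> bool) \<Rightarrow> complex" where
  "address_value \<alpha> \<theta> b = (\<Sum>n. address_term \<alpha> \<theta> b n)"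

definition psi :: "complex \<Rightarrow> real \<Rightarrow> bool \<Rightarrow> complex \<Rightarrow> complex" where
  "psi \<alpha> \<theta> c = (if c then psi2 \<alpha> \<theta> else psi1 \<alpha>)"

lemma hits_Suc_shift: "hits b (Suc n) = of_bool (b 0) + hits (shift b) n"
  by (induction n) (auto simp: shift_def)

lemma cnj_iter_Suc: "cnj_iter \<alpha> (Suc k) = cnj (cnj_iter \<alpha> k)"
  by (simp add: cnj_iter_def)

text \<open>The flip \<open>1 \<leftrightarrow> e\<^sup>i\<^sup>\<theta>\<close> is the reflection \<open>z \<mapsto> e\<^sup>i\<^sup>\<theta> \<cdot> cnj z\<close>; this is why the second map of the
  system has to involve complex conjugation.\<close>

lemma phase_Suc: "phase \<theta> (Suc k) = cis \<theta> * cnj (phase \<theta> k)"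
  by (simp add: phase_def cis_cnj cis_mult)

lemma address_term_0: "address_term \<alpha> \<theta> b 0 = (if b 0 then \<alpha> else 0)"
  by (simp add: address_term_def address_digit_def phase_def cnj_iter_def)

lemma address_term_Suc:
  "address_term \<alpha> \<theta> b (Suc n) =
     (if b 0 then \<alpha> * cis \<theta> * cnj (address_term \<alpha> \<theta> (shift b) n)
      else \<alpha> * address_term \<alpha> \<theta> (shift b) n)"
proof -
  have digit: "address_digit \<theta> b (Suc n) =
      (if b 0 then cis \<theta> * cnj (address_digit \<theta> (shift b) n) else address_digit \<theta> (shift b) n)"
    unfolding address_digit_def hits_Suc_shift by (auto simp: phase_Suc shift_def)
  have "(\<Prod>j\<le>Suc n. cnj_iter \<alpha> (hits b j)) = \<alpha> * (\<Prod>j\<le>n. cnj_iter \<alpha> (hits b (Suc j)))"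
    by (subst prod.atMost_Suc_shift) (simp add: cnj_iter_def)
  also have "\<dots> = \<alpha> * (if b 0 then cnj (\<Prod>j\<le>n. cnj_iter \<alpha> (hits (shift b) j))
                            else (\<Prod>j\<le>n. cnj_iter \<alpha> (hits (shift b) j)))"
    by (simp add: hits_Suc_shift cnj_iter_Suc del: hits.simps)
  finally show ?thesis
    by (simp add: address_term_def digit del: prod.atMost_Suc)
qed

lemma norm_address_term_le: "norm (address_term \<alpha> \<theta> b n) \<le> norm \<alpha> ^ Suc n"
proof -
  have "norm (\<Prod>j\<le>n. cnj_iter \<alpha> (hits b j)) = (\<Prod>j\<le>n. norm \<alpha>)"
    unfolding prod_norm[symmetric] by (intro prod.cong) (auto simp: cnj_iter_def)
  moreover have "norm (address_digit \<theta> b n) \<le> 1"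
    by (simp add: address_digit_def phase_def)
  ultimately show ?thesis
    unfolding address_term_def norm_mult by (simp add: mult_left_le_one_le)
qed

lemma summable_address_term:
  assumes "norm \<alpha> < 1"
  shows "summable (address_term \<alpha> \<theta> b)"
proof (rule summable_comparison_test')
  show "summable (\<lambda>n. norm \<alpha> * norm \<alpha> ^ n)"
    using assms by (intro summable_mult summable_geometric) simp
  show "norm (address_term \<alpha> \<theta> b n) \<le> norm \<alpha> * norm \<alpha> ^ n" if "n \<ge> 0" for n
    using norm_address_term_le[of \<alpha> \<theta> b n] by simp
qed

lemma bounded_range_address_value:
  assumes "norm \<alpha> < 1"
  shows "bounded (range (address_value \<alpha> \<theta>))"
proof -
  have "norm (address_value \<alpha> \<theta> b) \<le> (\<Sum>n. norm \<alpha> ^ Suc n)" for b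
    unfolding address_value_def
    using assms by (intro norm_suminf_le norm_address_term_le summable_Suc_iff[THEN iffD2]
        summable_geometric) simp
  then show ?thesis
    by (auto simp: bounded_iff)
qed

lemma address_value_shift:
  assumes "norm \<alpha> < 1"
  shows "address_value \<alpha> \<theta> b = psi \<alpha> \<theta> (b 0) (address_value \<alpha> \<theta> (shift b))"
proof -
  have tail: "address_term \<alpha> \<theta> (shift b) sums address_value \<alpha> \<theta> (shift b)"
    unfolding address_value_def by (intro summable_sums summable_address_term assms)
  then have tail_cnj: "(\<lambda>n. cnj (address_term \<alpha> \<theta> (shift b) n)) sums
      cnj (address_value \<alpha> \<theta> (shift b))"
    by (simp add: sums_cnj)
  have "address_value \<alpha> \<theta> b = (\<Sum>n. address_term \<alpha> \<theta> b (Suc n)) + address_term \<alpha> \<theta> b 0"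
    unfolding address_value_def
    using suminf_split_head[OF summable_address_term[OF assms, of \<theta> b]] by simp
  also have "(\<Sum>n. address_term \<alpha> \<theta> b (Suc n)) =
      (if b 0 then \<alpha> * cis \<theta> * cnj (address_value \<alpha> \<theta> (shift b))
       else \<alpha> * address_value \<alpha> \<theta> (shift b))"
    using sums_unique[OF sums_mult[OF tail, of \<alpha>]]
      sums_unique[OF sums_mult[OF tail_cnj, of "\<alpha> * cis \<theta>"]]
    by (simp add: address_term_Suc)
  finally show ?thesis
    by (simp add: psi_def psi1_def psi2_def address_term_0)
qed

section \<open>Invariant sets of the iterated function system\<close>

lemma dist_psi: "dist (psi \<alpha> \<theta> c z) (psi \<alpha> \<theta> c w) = norm \<alpha> * dist z w"
proof (cases c)
  case True
  have "psi \<alpha> \<theta> c z - psi \<alpha> \<theta> c w = \<alpha> * cis \<theta> * cnj (z - w)"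
    using True by (simp add: psi_def psi2_def right_diff_distrib)
  then show ?thesis
    by (simp only: dist_norm norm_mult complex_mod_cnj norm_cis mult_1_right)
next
  case False
  have "psi \<alpha> \<theta> c z - psi \<alpha> \<theta> c w = \<alpha> * (z - w)"
    using False by (simp add: psi_def psi1_def right_diff_distrib)
  then show ?thesis
    by (simp only: dist_norm norm_mult)
qed

lemma continuous_on_psi: "continuous_on S (psi \<alpha> \<theta> c)"
  unfolding psi_def psi1_def psi2_def by (cases c; simp) (intro continuous_intros)+

lemma power_mult_le_imp_le_0:
  fixes r M d :: real
  assumes "0 \<le> r" "r < 1" "\<And>n. d \<le> r ^ n * M"
  shows "d \<le> 0"
proof (rule tendsto_lowerbound)
  show "(\<lambda>n. r ^ n * M) \<longlonglongrightarrow> 0"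
    using tendsto_mult_right[OF LIMSEQ_realpow_zero[OF assms(1,2)], of M] by simp
qed (use assms(3) in auto)

text \<open>Reading the invariance backwards from a point yields an infinite address, and contraction
  forces the point to be the value of that address. Closedness of the set of values follows from
  this without a topology on the space of addresses.\<close>

lemma bounded_invariant_subset:
  assumes \<alpha>: "norm \<alpha> < 1" and "bounded K"
    and inv: "K \<subseteq> psi1 \<alpha> ` K \<union> psi2 \<alpha> \<theta> ` K"
  shows "K \<subseteq> range (address_value \<alpha> \<theta>)"
proof
  fix z assume "z \<in> K"
  have "\<exists>c y. y \<in> K \<and> x = psi \<alpha> \<theta> c y" if x: "x \<in> K" for x
  proof -
    consider y where "y \<in> K" "x = psi1 \<alpha> y" | y where "y \<in> K" "x = psi2 \<alpha> \<theta> y"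
      using inv x by blast
    then show ?thesis
    proof cases
      case 1
      then show ?thesis
        by (intro exI[of _ False] exI[of _ y]) (simp add: psi_def)
    next
      case 2
      then show ?thesis
        by (intro exI[of _ True] exI[of _ y]) (simp add: psi_def)
    qed
  qed
  then obtain c y where y: "\<And>x. x \<in> K \<Longrightarrow> y x \<in> K"
    and preimage: "\<And>x. x \<in> K \<Longrightarrow> psi \<alpha> \<theta> (c x) (y x) = x"
    by metis
  define orbit where "orbit n = (y ^^ n) z" for n
  define b where "b n = c (orbit n)" for n
  have orbit: "orbit n \<in> K" for n
    by (induction n) (use \<open>z \<in> K\<close> y in \<open>auto simp: orbit_def\<close>)
  then have step: "orbit n = psi \<alpha> \<theta> (b n) (orbit (Suc n))" for n
    using preimage[OF orbit[of n]] by (simp add: b_def orbit_def)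
  have "(shift ^^ n) b k = b (n + k)" for n k
    by (induction n arbitrary: k) (auto simp: shift_def)
  then have val: "address_value \<alpha> \<theta> ((shift ^^ n) b) =
      psi \<alpha> \<theta> (b n) (address_value \<alpha> \<theta> ((shift ^^ Suc n) b))" for n
    using address_value_shift[OF \<alpha>, of \<theta> "(shift ^^ n) b"] by simp
  have "bounded (K \<union> range (address_value \<alpha> \<theta>))"
    using assms bounded_range_address_value by simp
  then obtain M where M: "\<And>u v. u \<in> K \<Longrightarrow> v \<in> range (address_value \<alpha> \<theta>) \<Longrightarrow> dist u v \<le> M"
    by (metis bounded_two_points UnI1 UnI2)
  have pull: "dist z (address_value \<alpha> \<theta> b) =
      norm \<alpha> ^ n * dist (orbit n) (address_value \<alpha> \<theta> ((shift ^^ n) b))" for n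
  proof (induction n)
    case (Suc n)
    have "dist (orbit n) (address_value \<alpha> \<theta> ((shift ^^ n) b)) =
        norm \<alpha> * dist (orbit (Suc n)) (address_value \<alpha> \<theta> ((shift ^^ Suc n) b))"
      unfolding step[of n] val[of n] dist_psi ..
    with Suc show ?case
      by (simp only: power_Suc mult_ac)
  qed (simp add: orbit_def)
  have "dist z (address_value \<alpha> \<theta> b) \<le> norm \<alpha> ^ n * M" for n
    unfolding pull[of n] by (intro mult_left_mono M orbit) auto
  from power_mult_le_imp_le_0[OF norm_ge_zero \<alpha> this]
  have "z = address_value \<alpha> \<theta> b"
    by simp
  then show "z \<in> range (address_value \<alpha> \<theta>)"
    by blast
qed

lemma closed_invariant_superset:
  assumes \<alpha>: "norm \<alpha> < 1" and "closed K" "bounded K" "K \<noteq> {}"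
    and inv: "psi1 \<alpha> ` K \<union> psi2 \<alpha> \<theta> ` K \<subseteq> K"
  shows "range (address_value \<alpha> \<theta>) \<subseteq> K"
proof (safe)
  fix b
  have "bounded (K \<union> range (address_value \<alpha> \<theta>))"
    using assms bounded_range_address_value by simp
  then obtain M where M: "\<And>u v. u \<in> K \<Longrightarrow> v \<in> range (address_value \<alpha> \<theta>) \<Longrightarrow> dist u v \<le> M"
    by (metis bounded_two_points UnI1 UnI2)
  have approx: "\<exists>u\<in>K. dist u (address_value \<alpha> \<theta> b) \<le> norm \<alpha> ^ n * M" for n b
  proof (induction n arbitrary: b)
    case 0
    then show ?case
      using \<open>K \<noteq> {}\<close> M by auto
  next
    case (Suc n)
    then obtain u where u: "u \<in> K" "dist u (address_value \<alpha> \<theta> (shift b)) \<le> norm \<alpha> ^ n * M"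
      by blast
    then have "norm \<alpha> * dist u (address_value \<alpha> \<theta> (shift b)) \<le> norm \<alpha> * (norm \<alpha> ^ n * M)"
      by (intro mult_left_mono) auto
    then have "dist (psi \<alpha> \<theta> (b 0) u) (address_value \<alpha> \<theta> b) \<le> norm \<alpha> ^ Suc n * M"
      by (simp add: address_value_shift[OF \<alpha>, of \<theta> b] dist_psi mult_ac)
    moreover have "psi \<alpha> \<theta> (b 0) u \<in> K"
      using u inv by (auto simp: psi_def)
    ultimately show ?case
      by blast
  qed
  have "infdist (address_value \<alpha> \<theta> b) K \<le> norm \<alpha> ^ n * M" for n
    using approx[where n = n and b = b] by (metis dist_commute infdist_le order_trans)
  from power_mult_le_imp_le_0[OF norm_ge_zero \<alpha> this]
  have "infdist (address_value \<alpha> \<theta> b) K = 0"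
    using infdist_nonneg[of "address_value \<alpha> \<theta> b" K] by linarith
  then show "address_value \<alpha> \<theta> b \<in> K"
    using in_closed_iff_infdist_zero[OF \<open>closed K\<close> \<open>K \<noteq> {}\<close>] by simp
qed

lemma compact_invariant_eq:
  assumes "norm \<alpha> < 1" "compact K" "K \<noteq> {}"
    and "K = psi1 \<alpha> ` K \<union> psi2 \<alpha> \<theta> ` K"
  shows "K = range (address_value \<alpha> \<theta>)"
proof (rule antisym)
  show "K \<subseteq> range (address_value \<alpha> \<theta>)"
    by (intro bounded_invariant_subset compact_imp_bounded assms(1,2) equalityD1[OF assms(4)])
  show "range (address_value \<alpha> \<theta>) \<subseteq> K"
    by (intro closed_invariant_superset compact_imp_bounded compact_imp_closed assms(1-3)
        equalityD2[OF assms(4)])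
qed

lemma range_address_value_invariant:
  assumes "norm \<alpha> < 1"
  shows "range (address_value \<alpha> \<theta>) =
    psi1 \<alpha> ` range (address_value \<alpha> \<theta>) \<union> psi2 \<alpha> \<theta> ` range (address_value \<alpha> \<theta>)"
proof
  show "range (address_value \<alpha> \<theta>) \<subseteq>
      psi1 \<alpha> ` range (address_value \<alpha> \<theta>) \<union> psi2 \<alpha> \<theta> ` range (address_value \<alpha> \<theta>)"
  proof safe
    fix b
    assume "address_value \<alpha> \<theta> b \<notin> psi2 \<alpha> \<theta> ` range (address_value \<alpha> \<theta>)"
    then show "address_value \<alpha> \<theta> b \<in> psi1 \<alpha> ` range (address_value \<alpha> \<theta>)"
      using address_value_shift[OF assms, of \<theta> b] by (auto simp: psi_def split: if_splits)
  qed
  have "psi \<alpha> \<theta> c (address_value \<alpha> \<theta> b) = address_value \<alpha> \<theta> (case_nat c b)" for c b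
    using address_value_shift[OF assms, of \<theta> "case_nat c b"] by (simp add: shift_def[abs_def])
  from this[of True] this[of False]
  show "psi1 \<alpha> ` range (address_value \<alpha> \<theta>) \<union> psi2 \<alpha> \<theta> ` range (address_value \<alpha> \<theta>)
      \<subseteq> range (address_value \<alpha> \<theta>)"
    by (auto simp: psi_def)
qed

lemma closure_image_bounded:
  fixes f :: "'a::heine_borel \<Rightarrow> 'b::t2_space"
  assumes "bounded S" "continuous_on (closure S) f"
  shows "closure (f ` S) = f ` closure S"
proof
  have "closed (f ` closure S)"
    using assms by (intro compact_imp_closed compact_continuous_image) (auto simp: compact_closure)
  then show "closure (f ` S) \<subseteq> f ` closure S"
    by (intro closure_minimal image_mono closure_subset)
  show "f ` closure S \<subseteq> closure (f ` S)"
    using assms(2) by (rule image_closure_subset) (auto intro: closure_subset[THEN subsetD])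
qed

text \<open>The closure of the set of values serves as the compact invariant set whose existence is
  needed; uniqueness then shows that the set of values was closed already.\<close>

lemma K3_eq_range_address_value:
  assumes "norm \<alpha> < 1"
  shows "K3 \<alpha> \<theta> = range (address_value \<alpha> \<theta>)"
proof -
  let ?R = "range (address_value \<alpha> \<theta>)"
  let ?P = "\<lambda>K. compact K \<and> K \<noteq> {} \<and> K = psi1 \<alpha> ` K \<union> psi2 \<alpha> \<theta> ` K"
  have bnd: "bounded ?R"
    by (rule bounded_range_address_value[OF assms])
  have image: "closure (psi \<alpha> \<theta> c ` ?R) = psi \<alpha> \<theta> c ` closure ?R" for c
    by (rule closure_image_bounded[OF bnd continuous_on_psi])
  have "closure ?R = closure (psi1 \<alpha> ` ?R) \<union> closure (psi2 \<alpha> \<theta> ` ?R)"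
    unfolding closure_Un[symmetric] range_address_value_invariant[OF assms, symmetric] ..
  also have "\<dots> = psi1 \<alpha> ` closure ?R \<union> psi2 \<alpha> \<theta> ` closure ?R"
    using image[of True] image[of False] unfolding psi_def by simp
  finally have "closure ?R = psi1 \<alpha> ` closure ?R \<union> psi2 \<alpha> \<theta> ` closure ?R" .
  moreover have "compact (closure ?R)" "closure ?R \<noteq> {}"
    using bnd by (simp_all add: compact_closure)
  ultimately have P: "?P (closure ?R)"
    by blast
  have unique: "K = ?R" if "?P K" for K
    using that by (intro compact_invariant_eq[OF assms]) (elim conjE, assumption)+
  have "closure ?R = ?R"
    by (rule unique[OF P])
  have "?P ?R"
    using P unfolding \<open>closure ?R = ?R\<close> .
  from the_equality[of ?P, OF this unique] show ?thesis
    unfolding K3_def .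
qed

section \<open>Alternating sequences in terms of addresses\<close>

text \<open>An address is indexed from \<open>0\<close>, a digit sequence from \<open>1\<close>.\<close>

abbreviation support :: "(nat \<Rightarrow> complex) \<Rightarrow> nat \<Rightarrow> bool" where
  "support \<delta> \<equiv> \<lambda>n. \<delta> (Suc n) \<noteq> 0"

lemma hits_eq_0_iff: "hits b n = 0 \<longleftrightarrow> (\<forall>j<n. \<not> b j)"
  by (induction n) (auto simp: less_Suc_eq)

lemma num_nonzero_eq_hits: "num_nonzero \<delta> n = hits (support \<delta>) n"
proof (induction n)
  case (Suc n)
  have "{j \<in> {1..Suc n}. \<delta> j \<noteq> 0} =
      (if \<delta> (Suc n) \<noteq> 0 then insert (Suc n) {j \<in> {1..n}. \<delta> j \<noteq> 0} else {j \<in> {1..n}. \<delta> j \<noteq> 0})"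
    by (auto simp: le_Suc_eq)
  with Suc show ?case
    by (simp add: num_nonzero_def)
qed (simp add: num_nonzero_def)

lemma last_nonzero_cases:
  assumes "hits (support \<delta>) n > 0"
  obtains m where "m < n" "last_nonzero \<delta> n = Suc m" "\<delta> (Suc m) \<noteq> 0"
    "hits (support \<delta>) n = Suc (hits (support \<delta>) m)"
proof -
  let ?S = "{j \<in> {1..n}. \<delta> j \<noteq> 0}"
  have "?S \<noteq> {}"
    using assms by (auto simp: num_nonzero_eq_hits[symmetric] num_nonzero_def card_gt_0_iff)
  then have "last_nonzero \<delta> n \<in> ?S"
    unfolding last_nonzero_def by (intro Max_in) auto
  then obtain m where m: "last_nonzero \<delta> n = Suc m" "m < n" "\<delta> (Suc m) \<noteq> 0"
    by (cases "last_nonzero \<delta> n") auto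
  have "j \<le> Suc m" if "j \<in> ?S" for j
    using that unfolding m(1)[symmetric] last_nonzero_def by (intro Max_ge) auto
  with m(2) have "?S = {j \<in> {1..Suc m}. \<delta> j \<noteq> 0}"
    by auto
  then have "num_nonzero \<delta> n = num_nonzero \<delta> (Suc m)"
    by (simp add: num_nonzero_def)
  then show thesis
    using m by (intro that) (auto simp: num_nonzero_eq_hits)
qed

text \<open>The rule of the alternating condition relates a nonzero digit to the previous one; solving
  this recursion makes every nonzero digit explicit in terms of the first one.\<close>

lemma alternating_iff:
  "alternating \<theta> \<delta> \<longleftrightarrow> (\<exists>w. \<forall>n. \<delta> (Suc n) \<noteq> 0 \<longrightarrow> \<delta> (Suc n) = w * phase \<theta> (hits (support \<delta>) n))"
    (is "_ \<longleftrightarrow> (\<exists>w. \<forall>n. ?P w n)")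
proof -
  have next_phase: "(if odd (num_nonzero \<delta> (last_nonzero \<delta> n)) then cis \<theta> * \<delta> (last_nonzero \<delta> n)
      else cis (- \<theta>) * \<delta> (last_nonzero \<delta> n)) = w * phase \<theta> (hits (support \<delta>) n)"
    if "hits (support \<delta>) n > 0" "\<And>m. m < n \<Longrightarrow> ?P w m" for n w
  proof -
    obtain m where m: "m < n" "last_nonzero \<delta> n = Suc m" "\<delta> (Suc m) \<noteq> 0"
      "hits (support \<delta>) n = Suc (hits (support \<delta>) m)"
      using last_nonzero_cases[OF \<open>hits (support \<delta>) n > 0\<close>] by metis
    then have "\<delta> (Suc m) = w * phase \<theta> (hits (support \<delta>) m)"
      using that(2) by blast
    then show ?thesis
      using m by (simp add: num_nonzero_eq_hits phase_def cis_mult mult_ac)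
  qed
  have guard: "\<not> (\<forall>j\<in>{1..n}. \<delta> j = 0) \<longleftrightarrow> hits (support \<delta>) n > 0" for n
    by (auto simp: num_nonzero_eq_hits[symmetric] num_nonzero_def card_gt_0_iff)
  have pos: "n \<ge> 1" if "hits (support \<delta>) n > 0" for n
    using that by (cases n) auto
  have alt: "alternating \<theta> \<delta> \<longleftrightarrow> (\<forall>n. hits (support \<delta>) n > 0 \<longrightarrow> \<delta> (Suc n) \<noteq> 0 \<longrightarrow>
      \<delta> (Suc n) = (if odd (num_nonzero \<delta> (last_nonzero \<delta> n)) then cis \<theta> * \<delta> (last_nonzero \<delta> n)
      else cis (- \<theta>) * \<delta> (last_nonzero \<delta> n)))"
    unfolding alternating_def guard Let_def Suc_eq_plus1[symmetric] using pos by blast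
  show ?thesis
  proof
    assume "\<exists>w. \<forall>n. ?P w n"
    then show "alternating \<theta> \<delta>"
      unfolding alt using next_phase by metis
  next
    assume A: "alternating \<theta> \<delta>"
    \<comment> \<open>If no digit is nonzero, every value of \<open>w\<close> will do.\<close>
    define w where "w = \<delta> (Suc (LEAST n. \<delta> (Suc n) \<noteq> 0))"
    have "?P w n" for n
    proof (induction n rule: less_induct)
      case (less n)
      show ?case
      proof (cases "hits (support \<delta>) n = 0")
        case True
        then have "(LEAST n. \<delta> (Suc n) \<noteq> 0) = n" if "\<delta> (Suc n) \<noteq> 0"
          using that by (intro Least_equality) (auto simp: hits_eq_0_iff not_less[symmetric])
        with True show ?thesis
          by (simp add: w_def phase_def)
      next
        case False
        then have later: "hits (support \<delta>) n > 0"
          by simp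
        show ?thesis
        proof
          assume "support \<delta> n"
          show "\<delta> (Suc n) = w * phase \<theta> (hits (support \<delta>) n)"
            by (rule trans[OF A[unfolded alt, rule_format, OF later \<open>support \<delta> n\<close>]
                  next_phase[where n = n and w = w, OF later less]])
        qed
      qed
    qed
    then show "\<exists>w. \<forall>n. ?P w n"
      by blast
  qed
qed

text \<open>Periodicity matters when the first nonzero digit is \<open>e\<^sup>i\<^sup>(\<^sup>p\<^sup>-\<^sup>1\<^sup>)\<^sup>\<theta>\<close>: the second one is then
  \<open>e\<^sup>i\<^sup>p\<^sup>\<theta>\<close>, which lies in the digit set only because it equals \<open>1\<close>.\<close>

lemma W_alt_iff:
  assumes "p \<ge> 1" and period: "cis \<theta> ^ p = 1"
  shows "\<delta> \<in> W_alt p \<theta> \<longleftrightarrow>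
    (\<exists>k<p. \<forall>n. \<delta> (Suc n) = cis \<theta> ^ k * address_digit \<theta> (support \<delta>) n)"
proof
  assume W: "\<delta> \<in> W_alt p \<theta>"
  then obtain w where w: "\<And>n. \<delta> (Suc n) \<noteq> 0 \<Longrightarrow> \<delta> (Suc n) = w * phase \<theta> (hits (support \<delta>) n)"
    unfolding W_alt_def alternating_iff by blast
  show "\<exists>k<p. \<forall>n. \<delta> (Suc n) = cis \<theta> ^ k * address_digit \<theta> (support \<delta>) n"
  proof (cases "\<exists>n. support \<delta> n")
    case True
    define m where "m = (LEAST n. support \<delta> n)"
    have m: "\<delta> (Suc m) \<noteq> 0"
      unfolding m_def using True by (rule LeastI_ex)
    have "hits (support \<delta>) m = 0"
      unfolding hits_eq_0_iff m_def using not_less_Least by blast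
    with w[OF m] have "\<delta> (Suc m) = w"
      by (simp add: phase_def)
    moreover have "\<delta> (Suc m) \<in> Delta p \<theta>"
      using W by (simp add: W_alt_def)
    ultimately obtain k where "k < p" "w = cis (real k * \<theta>)"
      using m by (auto simp: Delta_def)
    then have "k < p" "w = cis \<theta> ^ k"
      by (simp_all only: Complex.DeMoivre)
    have "\<delta> (Suc n) = cis \<theta> ^ k * address_digit \<theta> (support \<delta>) n" for n
    proof (cases "\<delta> (Suc n) = 0")
      case False
      from w[OF this] show ?thesis
        unfolding address_digit_def if_P[OF False] \<open>w = cis \<theta> ^ k\<close> .
    qed (simp add: address_digit_def)
    with \<open>k < p\<close> show ?thesis
      by blast
  next
    case False
    then show ?thesis
      using \<open>p \<ge> 1\<close> by (intro exI[of _ 0]) (auto simp: address_digit_def)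
  qed
next
  assume "\<exists>k<p. \<forall>n. \<delta> (Suc n) = cis \<theta> ^ k * address_digit \<theta> (support \<delta>) n"
  then obtain k where "k < p"
    and \<delta>: "\<And>n. \<delta> (Suc n) = cis \<theta> ^ k * address_digit \<theta> (support \<delta>) n"
    by blast
  have power_in: "cis \<theta> ^ l \<in> Delta p \<theta>" if "l \<le> p" for l
  proof (cases "l = p")
    case True
    then have "cis \<theta> ^ l = cis (real 0 * \<theta>)"
      by (simp add: period)
    then show ?thesis
      using \<open>p \<ge> 1\<close> unfolding Delta_def by (intro insertI2 CollectI exI[of _ 0]) auto
  qed (use that in \<open>auto simp: Delta_def Complex.DeMoivre\<close>)
  have nonzero_digit: "\<delta> (Suc n) = cis \<theta> ^ k * phase \<theta> (hits (support \<delta>) n)"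
    if "\<delta> (Suc n) \<noteq> 0" for n
    using \<delta>[of n] unfolding address_digit_def if_P[OF that] .
  have "\<delta> (Suc n) \<in> Delta p \<theta>" for n
  proof (cases "\<delta> (Suc n) = 0")
    case False
    from nonzero_digit[OF this] have "\<delta> (Suc n) = cis \<theta> ^ k \<or> \<delta> (Suc n) = cis \<theta> ^ Suc k"
      by (simp add: phase_def split: if_splits)
    then show ?thesis
      using power_in[of k] power_in[of "Suc k"] \<open>k < p\<close> by auto
  qed (simp add: Delta_def)
  then have "\<forall>n\<ge>1. \<delta> n \<in> Delta p \<theta>"
    by (metis One_nat_def Suc_le_D)
  moreover have "alternating \<theta> \<delta>"
    unfolding alternating_iff using nonzero_digit by blast
  ultimately show "\<delta> \<in> W_alt p \<theta>"
    by (simp add: W_alt_def)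
qed

lemma xi_eq_cnj_iter: "xi \<alpha> \<delta> (Suc n) = cnj_iter \<alpha> (hits (support \<delta>) n)"
  by (induction n) (auto simp: cnj_iter_def)

lemma alternating_sum_eq:
  assumes "norm \<alpha> < 1"
    and "\<And>n. \<delta> (Suc n) = c * address_digit \<theta> (support \<delta>) n"
  shows "(\<Sum>n. \<delta> (Suc n) * (\<Prod>j=1..Suc n. xi \<alpha> \<delta> j)) = c * address_value \<alpha> \<theta> (support \<delta>)"
proof -
  have "(\<Prod>j=1..Suc n. xi \<alpha> \<delta> j) = (\<Prod>j\<le>n. cnj_iter \<alpha> (hits (support \<delta>) j))" for n
    unfolding One_nat_def prod.shift_bounds_cl_Suc_ivl atLeast0AtMost
    by (intro prod.cong refl xi_eq_cnj_iter)
  then have "\<delta> (Suc n) * (\<Prod>j=1..Suc n. xi \<alpha> \<delta> j) = c * address_term \<alpha> \<theta> (support \<delta>) n" for n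
    using assms(2)[of n] by (simp add: address_term_def)
  then show ?thesis
    unfolding address_value_def
    by (simp add: suminf_mult[OF summable_address_term[OF assms(1)], symmetric])
qed

lemma X3_eq_rotated_values:
  assumes "norm \<alpha> < 1" "p \<ge> 1" "cis \<theta> ^ p = 1"
  shows "X3 p \<alpha> \<theta> = (\<Union>k<p. (\<lambda>z. cis \<theta> ^ k * z) ` range (address_value \<alpha> \<theta>))"
proof (intro equalityI subsetI)
  fix x assume "x \<in> X3 p \<alpha> \<theta>"
  then show "x \<in> (\<Union>k<p. (\<lambda>z. cis \<theta> ^ k * z) ` range (address_value \<alpha> \<theta>))"
    unfolding X3_def W_alt_iff[OF assms(2,3)] using alternating_sum_eq[OF assms(1)] by blast
next
  fix x assume "x \<in> (\<Union>k<p. (\<lambda>z. cis \<theta> ^ k * z) ` range (address_value \<alpha> \<theta>))"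
  then obtain k b where k: "k < p" and x: "x = cis \<theta> ^ k * address_value \<alpha> \<theta> b"
    by blast
  define \<delta> where "\<delta> n = cis \<theta> ^ k * address_digit \<theta> b (n - 1)" for n
  have "support \<delta> = b"
    by (auto simp: \<delta>_def address_digit_def phase_def)
  then have \<delta>: "\<delta> (Suc n) = cis \<theta> ^ k * address_digit \<theta> (support \<delta>) n" for n
    by (simp add: \<delta>_def)
  then have "\<delta> \<in> W_alt p \<theta>"
    unfolding W_alt_iff[OF assms(2,3)] using k by blast
  moreover have "x = (\<Sum>n. \<delta> (Suc n) * (\<Prod>j=1..Suc n. xi \<alpha> \<delta> j))"
    using alternating_sum_eq[of \<alpha> \<delta> "cis \<theta> ^ k" \<theta>, OF assms(1) \<delta>] \<open>support \<delta> = b\<close> x by simp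
  ultimately show "x \<in> X3 p \<alpha> \<theta>"
    unfolding X3_def by blast
qed

theorem theorem3p5:
  fixes \<alpha> :: complex and \<theta> :: real and p q :: nat
  assumes "norm \<alpha> < 1"
    and "p \<ge> 1"
    and "\<bar>\<theta>\<bar> = 2 * pi * real q / real p"
    and "2 * pi * real q / real p \<le> pi"
  shows "(\<Union>k<p. (\<lambda>z. cis \<theta> ^ k * z) ` K3 \<alpha> \<theta>) = X3 p \<alpha> \<theta>"
proof -
  have "real p * \<theta> = 2 * pi * real_of_int (int q) \<or> real p * \<theta> = 2 * pi * real_of_int (- int q)"
    using assms(2,3) by (auto simp: abs_if field_simps split: if_splits)
  then have "cis \<theta> ^ p = 1"
    unfolding Complex.DeMoivre by (elim disjE) (simp_all only: cis_multiple_2pi Ints_of_int)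
  then show ?thesis
    using assms X3_eq_rotated_values K3_eq_range_address_value by simp
qed

end
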